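(* Let $(\Omega,\mathcal{H},\hat{E})$ be a sublinear expectation space as described in the context. Suppose that $\{X_n\}_{n\ge 1}$ is a sequence in $L^1$ and that $|X_n|\leq Y$ for all $n\geq 1$, with $Y\in L_b^1$. Further suppose that $\{X_n\}$ converges to $X$ in capacity and that $X\in L_b^1$. Then $\{X_n\}$ converges to $X$ in $L^1$ norm, i.e. $\lim_{n\to\infty}\hat{E}[|X_n-X|]=0$.
   Context: Setting. $\Omega$ is a complete separable metric space with Borel $\sigma$-algebra $\mathcal{B}(\Omega)$. $\mathcal{H}$ is a linear space of real (measurable) functions on $\Omega$ such that: every constant belongs to $\mathcal{H}$; $X\in\mathcal{H}$ implies $|X|\in\mathcal{H}$; $X_1,\dots,X_n\in\mathcal{H}$ implies $\varphi(X_1,\dots,X_n)\in\mathcal{H}$ for every $\varphi:\mathbb{R}^n\to\mathbb{R}$ satisfying $|\varphi(x)-\varphi(y)|\le C(1+|x|^m+|y|^m)|x-y|$ for all $x,y$, for some $C>0$, $m\in\mathbb{N}$ depending on $\varphi$; $I_A\in\mathcal{H}$ for all $A\in\mathcal{B}(\Omega)$; and $f(X)\in\mathcal{H}$ for every $X\in\mathcal{H}$ and every bounded continuous $f:\mathbb{R}\to\mathbb{R}$. A sublinear expectation is a functional $\hat{E}:\mathcal{H}\to\mathbb{R}$ that is monotone ($X\ge Y\Rightarrow \hat{E}[X]\ge\hat{E}[Y]$), constant preserving ($\hat{E}[c]=c$), sub-additive ($\hat{E}[X+Y]\le\hat{E}[X]+\hat{E}[Y]$) and positively homogeneous ($\hat{E}[\lambda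 X]=\lambda\hat{E}[X]$, $\lambda\ge0$). It is assumed that there is a family $\mathcal{P}$ of probability measures on $(\Omega,\mathcal{B}(\Omega))$ with $\hat{E}[X]=\sup_{P\in\mathcal{P}}E_P[X]$ for all $X\in\mathcal{H}$. The capacity is $V(A):=\hat{E}[I_A]=\sup_{P\in\mathcal{P}}P(A)$ for $A\in\mathcal{B}(\Omega)$. Spaces. For $p\in[1,\infty)$ let $\|X\|_p=(\hat{E}[|X|^p])^{1/p}$, a seminorm. $L^p$ is the completion under $\|\cdot\|_p$ of $\{X\in\mathcal{H}:\|X\|_p<\infty\}$, modulo equality in $\|\cdot\|_p$. $L_b^p\subset L^p$ is the completion under $\|\cdot\|_p$ of the set of bounded functions $X\in\mathcal{H}$. Elements of $L^p$ are treated as random variables on $\Omega$, identified when they agree in $\|\cdot\|_p$, and $\hat{E}$ is given on them by the formula $\sup_{P\in\mathcal{P}}E_P[\cdot]$. Convergence in capacity. $\{X_n\}$ converges to $X$ in capacity if $\lim_{n\to\infty}V(\{|X_n-X|\ge\varepsilon\})=0$ for every $\varepsilon>0$. *)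

theory Defs
  imports "HOL-Probability.Probability"
begin

text \<open>
  A function of \<open>n\<close> real variables is rendered as a function of sequences. Only the first \<open>n\<close>
  coordinates enter the bound, so the condition also forces \<open>\<phi>\<close> to depend on those coordinates
  only, and such \<open>\<phi>\<close> correspond exactly to the locally Lipschitz functions on
  \<open>n\<close>-dimensional Euclidean space with polynomially growing Lipschitz constant.
\<close>

definition local_lipschitz_poly :: "nat \<Rightarrow> ((nat \<Rightarrow> real) \<Rightarrow> real) \<Rightarrow> bool" where
  "local_lipschitz_poly n \<phi> \<longleftrightarrow>
     (\<exists>C>0. \<exists>m::nat. \<forall>x y.
        \<bar>\<phi> x - \<phi> y\<bar> \<le> C * (1 + L2_set x {..<n} ^ m + L2_set y {..<n} ^ m)
                        * L2_set (\<lambda>i. x i - y i) {..<n})"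

text \<open>
  The functional \<open>E\<close> is a total function, but it is only constrained on \<open>H\<close>. The supremum in
  \<open>representation\<close> is taken in the extended reals; since the left-hand side is finite, it
  expresses that \<open>\<P>\<close> is nonempty and that the supremum is that of a set bounded above.
  Integrability is stated separately because the library integral of a non-integrable function
  is \<open>0\<close>.
\<close>

locale sublinear_expectation_space =
  fixes H :: "('a::polish_space \<Rightarrow> real) set"
    and E :: "('a \<Rightarrow> real) \<Rightarrow> real"
    and \<P> :: "'a measure set"
  assumes H_measurable: "X \<in> H \<Longrightarrow> X \<in> borel_measurable borel"
    and H_const: "(\<lambda>_. c) \<in> H"
    and H_add: "X \<in> H \<Longrightarrow> Y \<in> H \<Longrightarrow> (\<lambda>\<omega>. X \<omega> + Y \<omega>) \<in> H"
    and H_scale: "X \<in> H \<Longrightarrow> (\<lambda>\<omega>. c * X \<omega>) \<in> H"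
    and H_abs: "X \<in> H \<Longrightarrow> (\<lambda>\<omega>. \<bar>X \<omega>\<bar>) \<in> H"
    and H_lipschitz: "local_lipschitz_poly n \<phi> \<Longrightarrow> (\<And>i. i < n \<Longrightarrow> Xs i \<in> H)
                        \<Longrightarrow> (\<lambda>\<omega>. \<phi> (\<lambda>i. Xs i \<omega>)) \<in> H"
    and H_indicator: "A \<in> sets borel \<Longrightarrow> indicator A \<in> H"
    and H_bounded_continuous: "X \<in> H \<Longrightarrow> continuous_on UNIV (f :: real \<Rightarrow> real)
                        \<Longrightarrow> bounded (range f) \<Longrightarrow> (\<lambda>\<omega>. f (X \<omega>)) \<in> H"
    and E_mono: "X \<in> H \<Longrightarrow> Y \<in> H \<Longrightarrow> (\<And>\<omega>. Y \<omega> \<le> X \<omega>) \<Longrightarrow> E Y \<le> E X"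
    and E_const: "E (\<lambda>_. c) = c"
    and E_subadd: "X \<in> H \<Longrightarrow> Y \<in> H \<Longrightarrow> E (\<lambda>\<omega>. X \<omega> + Y \<omega>) \<le> E X + E Y"
    and E_pos_homogeneous: "X \<in> H \<Longrightarrow> 0 \<le> l \<Longrightarrow> E (\<lambda>\<omega>. l * X \<omega>) = l * E X"
    and prob: "P \<in> \<P> \<Longrightarrow> prob_space P"
    and sets_P: "P \<in> \<P> \<Longrightarrow> sets P = sets borel"
    and H_integrable: "X \<in> H \<Longrightarrow> P \<in> \<P> \<Longrightarrow> integrable P X"
    and representation: "X \<in> H \<Longrightarrow> ereal (E X) = (SUP P\<in>\<P>. ereal (\<integral>\<omega>. X \<omega> \<partial>P))"

definition capacity :: "(('a::topological_space \<Rightarrow> real) \<Rightarrow> real) \<Rightarrow> 'a set \<Rightarrow> real" where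
  "capacity E A = E (indicator A)"

definition converges_in_capacity ::
  "(('a::topological_space \<Rightarrow> real) \<Rightarrow> real) \<Rightarrow> (nat \<Rightarrow> 'a \<Rightarrow> real) \<Rightarrow> ('a \<Rightarrow> real) \<Rightarrow> bool" where
  "converges_in_capacity E Xs X \<longleftrightarrow>
     (\<forall>\<epsilon>>0. (\<lambda>n. capacity E {\<omega>. \<epsilon> \<le> \<bar>Xs n \<omega> - X \<omega>\<bar>}) \<longlonglongrightarrow> 0)"

text \<open>
  Elements of the spaces \<open>L\<^sup>p\<close> are equivalence classes, so relations between them are only
  meaningful outside a set of capacity zero.
\<close>

definition quasi_surely ::
  "(('a::topological_space \<Rightarrow> real) \<Rightarrow> real) \<Rightarrow> ('a \<Rightarrow> bool) \<Rightarrow> bool" where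
  "quasi_surely E Q \<longleftrightarrow> (\<exists>N\<in>sets borel. capacity E N = 0 \<and> {\<omega>. \<not> Q \<omega>} \<subseteq> N)"

text \<open>
  The sublinear expectation of an arbitrary nonnegative random variable, by the formula
  \<open>sup\<^sub>P E\<^sub>P\<close>; lemma \<open>upper_expectation_eq\<close> shows that it extends \<open>E\<close>. Using extended values,
  no integrability has to be presupposed.
\<close>

definition upper_expectation :: "'a measure set \<Rightarrow> ('a \<Rightarrow> real) \<Rightarrow> ennreal" where
  "upper_expectation \<P> X = (SUP P\<in>\<P>. \<integral>\<^sup>+\<omega>. ennreal (X \<omega>) \<partial>P)"

definition ennreal_root :: "real \<Rightarrow> ennreal \<Rightarrow> ennreal" where
  "ennreal_root p x = (if x = \<infinity> then \<infinity> else ennreal (enn2real x powr (1 / p)))"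

definition Lp_norm :: "'a measure set \<Rightarrow> real \<Rightarrow> ('a \<Rightarrow> real) \<Rightarrow> ennreal" where
  "Lp_norm \<P> p X = ennreal_root p (upper_expectation \<P> (\<lambda>\<omega>. \<bar>X \<omega>\<bar> powr p))"

text \<open>
  The completion of a set \<open>B\<close> of random variables under the seminorm, realised by random
  variables: all representatives of limits of sequences from \<open>B\<close>. Lemma
  \<open>Lp_norm_Cauchy_convergent\<close> shows that every Cauchy sequence has such a limit, so this is
  indeed the completion once functions at distance zero are identified.
\<close>

definition Lp_completion ::
  "'a::topological_space measure set \<Rightarrow> real \<Rightarrow> ('a \<Rightarrow> real) set \<Rightarrow> ('a \<Rightarrow> real) set" where
  "Lp_completion \<P> p B = {X \<in> borel_measurable borel.
     \<exists>Z. (\<forall>k. Z k \<in> B) \<and> (\<lambda>k. Lp_norm \<P> p (\<lambda>\<omega>. Z k \<omega> - X \<omega>)) \<longlonglongrightarrow> 0}"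

definition Lp ::
  "('a::topological_space \<Rightarrow> real) set \<Rightarrow> 'a measure set \<Rightarrow> real \<Rightarrow> ('a \<Rightarrow> real) set" where
  "Lp H \<P> p = Lp_completion \<P> p {X \<in> H. Lp_norm \<P> p X < \<infinity>}"

definition Lpb ::
  "('a::topological_space \<Rightarrow> real) set \<Rightarrow> 'a measure set \<Rightarrow> real \<Rightarrow> ('a \<Rightarrow> real) set" where
  "Lpb H \<P> p = Lp_completion \<P> p {X \<in> H. bounded (range X)}"

lemma (in sublinear_expectation_space) upper_expectation_eq:
  assumes X: "X \<in> H" and nonneg: "\<And>\<omega>. 0 \<le> X \<omega>"
  shows "upper_expectation \<P> X = ennreal (E X)"
proof -
  have "ennreal (E X) = e2ennreal (ereal (E X))"
    by (simp add: e2ennreal_ereal)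
  also have "\<dots> = e2ennreal (SUP P\<in>\<P>. ereal (\<integral>\<omega>. X \<omega> \<partial>P))"
    using representation[OF X] by simp
  also have "\<dots> = (SUP P\<in>\<P>. ennreal (\<integral>\<omega>. X \<omega> \<partial>P))"
  proof -
    have ne: "\<P> \<noteq> {}"
      using representation[OF X] by (auto simp: bot_ereal_def)
    have 0: "0 \<le> (SUP P\<in>\<P>. ereal (\<integral>\<omega>. X \<omega> \<partial>P))"
    proof -
      obtain P where "P \<in> \<P>" using ne by blast
      moreover have "0 \<le> ereal (\<integral>\<omega>. X \<omega> \<partial>P)" using nonneg by simp
      ultimately show ?thesis by (meson SUP_upper2)
    qed
    show ?thesis
    proof (rule antisym)
      have "(SUP P\<in>\<P>. ereal (\<integral>\<omega>. X \<omega> \<partial>P)) \<le> enn2ereal (SUP P\<in>\<P>. ennreal (\<integral>\<omega>. X \<omega> \<partial>P))"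
      proof (rule SUP_least)
        fix P assume "P \<in> \<P>"
        then have "enn2ereal (ennreal (\<integral>\<omega>. X \<omega> \<partial>P))
              \<le> enn2ereal (SUP P\<in>\<P>. ennreal (\<integral>\<omega>. X \<omega> \<partial>P))"
          unfolding less_eq_ennreal.rep_eq[symmetric] by (rule SUP_upper)
        then show "ereal (\<integral>\<omega>. X \<omega> \<partial>P) \<le> enn2ereal (SUP P\<in>\<P>. ennreal (\<integral>\<omega>. X \<omega> \<partial>P))"
          using nonneg by (simp add: enn2ereal_ennreal)
      qed
      then show "e2ennreal (SUP P\<in>\<P>. ereal (\<integral>\<omega>. X \<omega> \<partial>P)) \<le> (SUP P\<in>\<P>. ennreal (\<integral>\<omega>. X \<omega> \<partial>P))"
        by (metis e2ennreal_enn2ereal e2ennreal_mono)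
      show "(SUP P\<in>\<P>. ennreal (\<integral>\<omega>. X \<omega> \<partial>P)) \<le> e2ennreal (SUP P\<in>\<P>. ereal (\<integral>\<omega>. X \<omega> \<partial>P))"
        by (rule SUP_least) (metis SUP_upper e2ennreal_ereal e2ennreal_mono)
    qed
  qed
  also have "\<dots> = upper_expectation \<P> X"
    unfolding upper_expectation_def
    by (rule SUP_cong) (auto simp: nn_integral_eq_integral H_integrable[OF X] nonneg)
  finally show ?thesis ..
qed

lemma ennreal_root_less:
  assumes "0 < p" "0 < e" "ennreal_root p x < ennreal e"
  shows "x < ennreal (e powr p)"
proof -
  have fin: "x \<noteq> \<infinity>" using assms by (auto simp: ennreal_root_def)
  then obtain r where r: "x = ennreal r" "0 \<le> r" by (cases x) auto
  have "r powr (1/p) < e"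
    using assms r by (simp add: ennreal_root_def ennreal_less_iff)
  then have "(r powr (1/p)) powr p < e powr p"
    using assms by (intro powr_less_mono2) auto
  then show ?thesis using r assms by (simp add: powr_powr ennreal_less_iff)
qed

lemma ennreal_root_le:
  assumes "0 < p" "0 < e" "x \<le> ennreal (e powr p)"
  shows "ennreal_root p x \<le> ennreal e"
proof -
  have fin: "x \<noteq> \<infinity>" using assms by (auto simp: top_unique)
  then obtain r where r: "x = ennreal r" "0 \<le> r" by (cases x) auto
  have "r powr (1/p) \<le> (e powr p) powr (1/p)"
    using assms r by (intro powr_mono2) auto
  then show ?thesis using r assms by (simp add: ennreal_root_def powr_powr ennreal_leI)
qed

lemma Lp_norm_Cauchy_convergent:
  fixes Z :: "nat \<Rightarrow> 'a::topological_space \<Rightarrow> real"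
  assumes p: "1 \<le> p"
    and prob: "\<And>P. P \<in> \<P> \<Longrightarrow> prob_space P"
    and sets: "\<And>P. P \<in> \<P> \<Longrightarrow> sets P = sets borel"
    and Z: "\<And>k. Z k \<in> borel_measurable borel"
    and Cauchy: "\<And>e::real. 0 < e \<Longrightarrow>
        \<exists>N. \<forall>j\<ge>N. \<forall>k\<ge>N. Lp_norm \<P> p (\<lambda>\<omega>. Z j \<omega> - Z k \<omega>) < ennreal e"
  shows "\<exists>X\<in>borel_measurable borel. (\<lambda>k. Lp_norm \<P> p (\<lambda>\<omega>. Z k \<omega> - X \<omega>)) \<longlonglongrightarrow> 0"
proof -
  have p0: "0 < p" using p by simp
  define D where "D P i j = (\<integral>\<^sup>+\<omega>. ennreal (\<bar>Z i \<omega> - Z j \<omega>\<bar> powr p) \<partial>P)" for P i j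
  have D: "\<exists>N. \<forall>j\<ge>N. \<forall>k\<ge>N. \<forall>P\<in>\<P>. D P j k \<le> ennreal (e powr p)" if e: "0 < e" for e
  proof -
    obtain N where N: "\<And>j k. j \<ge> N \<Longrightarrow> k \<ge> N \<Longrightarrow> Lp_norm \<P> p (\<lambda>\<omega>. Z j \<omega> - Z k \<omega>) < ennreal e"
      using Cauchy[OF e] by blast
    have "D P j k \<le> ennreal (e powr p)" if "j \<ge> N" "k \<ge> N" "P \<in> \<P>" for j k P
    proof -
      have "upper_expectation \<P> (\<lambda>\<omega>. \<bar>Z j \<omega> - Z k \<omega>\<bar> powr p) < ennreal (e powr p)"
        using ennreal_root_less[OF p0 e] N[OF that(1,2)] by (simp add: Lp_norm_def)
      moreover have "D P j k \<le> upper_expectation \<P> (\<lambda>\<omega>. \<bar>Z j \<omega> - Z k \<omega>\<bar> powr p)"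
        unfolding D_def upper_expectation_def using that(3) by (rule SUP_upper)
      ultimately show ?thesis by simp
    qed
    then show ?thesis by blast
  qed
  define b where "b k = (1/2::real) ^ k" for k :: nat
  have b: "0 < b k" for k by (simp add: b_def)
  have "\<exists>N. \<forall>k. \<forall>i\<ge>N k. \<forall>j\<ge>N k. \<forall>P\<in>\<P>. D P i j \<le> ennreal ((b k * b k) powr p)"
    using D[OF mult_pos_pos[OF b b]] by (intro choice allI) blast
  then obtain N where N: "\<And>k i j P. i \<ge> N k \<Longrightarrow> j \<ge> N k \<Longrightarrow> P \<in> \<P>
      \<Longrightarrow> D P i j \<le> ennreal ((b k * b k) powr p)" by blast
  define r where "r k = (\<Sum>i\<le>k. N i) + k" for k
  have rN: "N k \<le> r k" for k
    unfolding r_def by (simp add: sum.remove[of "{..k}" k])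
  have rS: "r k \<le> r (Suc k)" for k by (simp add: r_def)
  have rk: "k \<le> r k" for k by (simp add: r_def)
  define C where "C = {\<omega>. convergent (\<lambda>k. Z (r k) \<omega>)}"
  define X where "X \<omega> = (if \<omega> \<in> C then lim (\<lambda>k. Z (r k) \<omega>) else 0)" for \<omega>
  have C_meas: "C \<in> sets borel"
  proof -
    have "{\<omega>\<in>space borel. Cauchy (\<lambda>k. Z (r k) \<omega>)} \<in> sets borel"
      using Z by (intro sets_Collect_Cauchy) auto
    then show ?thesis by (simp add: C_def Cauchy_convergent_iff)
  qed
  have X_meas: "X \<in> borel_measurable borel"
  proof -
    have "(\<lambda>\<omega>. lim (\<lambda>k. Z (r k) \<omega>)) \<in> borel_measurable borel"
      using Z by (intro borel_measurable_lim_metric)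
    then show ?thesis unfolding X_def using C_meas by (intro measurable_If_set) auto
  qed
  have AE_C: "AE \<omega> in P. (\<lambda>k. Z (r k) \<omega>) \<longlonglongrightarrow> X \<omega>" if P: "P \<in> \<P>" for P
  proof -
    interpret prob_space P using prob[OF P] .
    have ZP[measurable]: "Z k \<in> borel_measurable P" for k
      using Z[of k] measurable_cong_sets[OF sets[OF P] refl, of borel] by blast
    define A where "A k = {\<omega>\<in>space P. ennreal (b k powr p)
        \<le> ennreal (\<bar>Z (r (Suc k)) \<omega> - Z (r k) \<omega>\<bar> powr p)}" for k
    have A_sets: "A k \<in> sets P" for k unfolding A_def by measurable
    have A_le: "emeasure P (A k) \<le> ennreal (b k)" for k
    proof -
      have "ennreal (b k powr p) * emeasure P (A k)
          = (\<integral>\<^sup>+\<omega>. ennreal (b k powr p) * indicator (A k) \<omega> \<partial>P)"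
        using A_sets by (simp add: nn_integral_cmult_indicator)
      also have "\<dots> \<le> D P (r (Suc k)) (r k)"
        unfolding D_def by (intro nn_integral_mono) (auto simp: A_def indicator_def)
      also have "\<dots> \<le> ennreal ((b k * b k) powr p)"
        using rN[of k] rS[of k] P by (intro N) auto
      also have "\<dots> = ennreal (b k powr p) * ennreal (b k powr p)"
        using b[of k] by (simp add: powr_mult ennreal_mult)
      finally have "emeasure P (A k) \<le> ennreal (b k powr p)"
        using b[of k] by (simp add: ennreal_mult_le_mult_iff)
      also have "\<dots> \<le> ennreal (b k)"
      proof -
        have "b k \<le> 1" by (simp add: b_def power_le_one)
        then have "b k powr p \<le> b k powr 1" using b[of k] p by (intro powr_mono') auto
        then show ?thesis using b[of k] by (simp add: ennreal_leI)
      qed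
      finally show ?thesis .
    qed
    have "AE \<omega> in P. eventually (\<lambda>k. \<omega> \<in> space P - A k) sequentially"
    proof (rule borel_cantelli_AE1)
      show "summable (\<lambda>k. measure P (A k))"
      proof (rule summable_comparison_test')
        show "summable b" unfolding b_def by (rule summable_geometric) simp
        show "norm (measure P (A k)) \<le> b k" for k
          using A_le[of k] b[of k] by (simp add: emeasure_eq_measure ennreal_le_iff)
      qed
    qed (use A_sets in \<open>auto simp: emeasure_eq_measure\<close>)
    then show ?thesis
    proof eventually_elim
      case (elim \<omega>)
      then obtain K where K: "\<And>k. k \<ge> K \<Longrightarrow> \<omega> \<in> space P - A k"
        by (auto simp: eventually_sequentially)
      have "summable (\<lambda>k. Z (r (Suc k)) \<omega> - Z (r k) \<omega>)"
      proof (rule summable_comparison_test')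
        show "summable b" unfolding b_def by (rule summable_geometric) simp
        show "norm (Z (r (Suc k)) \<omega> - Z (r k) \<omega>) \<le> b k" if "k \<ge> K" for k
        proof (rule ccontr)
          assume "\<not> ?thesis"
          then have "b k powr p \<le> \<bar>Z (r (Suc k)) \<omega> - Z (r k) \<omega>\<bar> powr p"
            using b[of k] p0 by (intro powr_mono2) auto
          then show False using K[OF that] by (auto simp: A_def ennreal_leI)
        qed
      qed
      then have "convergent (\<lambda>k. \<Sum>i<k. Z (r (Suc i)) \<omega> - Z (r i) \<omega>)"
        by (simp add: summable_iff_convergent)
      then have "convergent (\<lambda>k. Z (r k) \<omega> - Z (r 0) \<omega>)"
        by (simp add: sum_lessThan_telescope[of "\<lambda>k. Z (r k) \<omega>"])
      then have "convergent (\<lambda>k. Z (r k) \<omega> - Z (r 0) \<omega> + Z (r 0) \<omega>)"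
        by (intro convergent_add convergent_const)
      then have "\<omega> \<in> C" by (simp add: C_def)
      then show ?case unfolding X_def by (simp add: C_def convergent_LIMSEQ_iff)
    qed
  qed
  have small: "\<exists>M. \<forall>k\<ge>M. Lp_norm \<P> p (\<lambda>\<omega>. Z k \<omega> - X \<omega>) \<le> ennreal e" if e: "0 < e" for e
  proof -
    obtain M where M: "\<And>j k P. j \<ge> M \<Longrightarrow> k \<ge> M \<Longrightarrow> P \<in> \<P> \<Longrightarrow> D P j k \<le> ennreal (e powr p)"
      using D[OF e] by blast
    have "Lp_norm \<P> p (\<lambda>\<omega>. Z k \<omega> - X \<omega>) \<le> ennreal e" if k: "k \<ge> M" for k
    proof -
      have "(\<integral>\<^sup>+\<omega>. ennreal (\<bar>Z k \<omega> - X \<omega>\<bar> powr p) \<partial>P) \<le> ennreal (e powr p)" if P: "P \<in> \<P>" for P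
      proof -
        have ZP[measurable]: "Z k \<in> borel_measurable P" for k
          using Z[of k] measurable_cong_sets[OF sets[OF P] refl, of borel] by blast
        have "(\<integral>\<^sup>+\<omega>. ennreal (\<bar>Z k \<omega> - X \<omega>\<bar> powr p) \<partial>P)
            = (\<integral>\<^sup>+\<omega>. liminf (\<lambda>j. ennreal (\<bar>Z k \<omega> - Z (r j) \<omega>\<bar> powr p)) \<partial>P)"
        proof (rule nn_integral_cong_AE)
          show "AE \<omega> in P. ennreal (\<bar>Z k \<omega> - X \<omega>\<bar> powr p)
              = liminf (\<lambda>j. ennreal (\<bar>Z k \<omega> - Z (r j) \<omega>\<bar> powr p))"
            using AE_C[OF P]
          proof eventually_elim
            case (elim \<omega>)
            have "(\<lambda>j. \<bar>Z k \<omega> - Z (r j) \<omega>\<bar> powr p) \<longlonglongrightarrow> \<bar>Z k \<omega> - X \<omega>\<bar> powr p"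
              using p0 by (intro tendsto_powr' tendsto_intros elim) auto
            then have "(\<lambda>j. ennreal (\<bar>Z k \<omega> - Z (r j) \<omega>\<bar> powr p))
                \<longlonglongrightarrow> ennreal (\<bar>Z k \<omega> - X \<omega>\<bar> powr p)"
              by (rule tendsto_ennrealI)
            then show ?case
              by (intro lim_imp_Liminf[symmetric]) auto
          qed
        qed
        also have "\<dots> \<le> liminf (\<lambda>j. D P k (r j))"
          unfolding D_def by (intro nn_integral_liminf) measurable
        also have "\<dots> \<le> limsup (\<lambda>j. D P k (r j))"
          by (intro Liminf_le_Limsup) simp
        also have "\<dots> \<le> ennreal (e powr p)"
        proof (rule Limsup_bounded)
          show "eventually (\<lambda>j. D P k (r j) \<le> ennreal (e powr p)) sequentially"
            using eventually_ge_at_top[of M]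
            by eventually_elim (use M k P rk order_trans in blast)
        qed
        finally show ?thesis .
      qed
      then show ?thesis unfolding Lp_norm_def upper_expectation_def
        by (intro ennreal_root_le p0 e SUP_least)
    qed
    then show ?thesis by blast
  qed
  have "(\<lambda>k. Lp_norm \<P> p (\<lambda>\<omega>. Z k \<omega> - X \<omega>)) \<longlonglongrightarrow> 0"
  proof (rule order_tendstoI)
    fix a :: ennreal assume a: "0 < a"
    obtain e :: real where e: "0 < e" "ennreal e < a"
    proof -
      obtain y where y: "0 < y" "y < a" using dense[OF a] by blast
      then have "y \<noteq> \<infinity>" by auto
      then obtain s where "y = ennreal s" "0 \<le> s" by (cases y) auto
      then show thesis using y that[of s] by auto
    qed
    from small[OF e(1)] show "eventually (\<lambda>k. Lp_norm \<P> p (\<lambda>\<omega>. Z k \<omega> - X \<omega>) < a) sequentially"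
      using e(2) by (auto simp: eventually_sequentially intro: le_less_trans)
  qed simp
  then show ?thesis using X_meas by blast
qed

end

theory Submission
  imports Defs
begin

text \<open>
  Approximate \<open>Y\<close> and \<open>X\<close> by bounded functions \<open>U\<close> and \<open>Z\<close> with a common bound \<open>M\<close>. Quasi-surely
  \<open>\<bar>X\<^sub>n - X\<bar>\<close> is at most \<open>d\<close> off the set \<open>{d \<le> \<bar>X\<^sub>n - X\<bar>}\<close>, and at most
  \<open>Y + \<bar>X\<bar> \<le> \<bar>U - Y\<bar> + \<bar>Z - X\<bar> + 2 M\<close> on it, so the expectation of \<open>\<bar>X\<^sub>n - X\<bar>\<close> exceeds the
  approximation errors by at most \<open>d\<close> plus \<open>2 M\<close> times the capacity of that set, which tends
  to \<open>0\<close>.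
\<close>

lemma Lp_norm_one: "Lp_norm \<P> 1 X = upper_expectation \<P> (\<lambda>\<omega>. \<bar>X \<omega>\<bar>)"
proof -
  have "ennreal_root 1 x = x" for x
    by (cases x) (auto simp: ennreal_root_def)
  then show ?thesis
    by (simp add: Lp_norm_def)
qed

text \<open>This is how membership in \<open>Lpb\<close> enters: a late enough term of an
  approximating sequence is itself bounded, and its bound \<open>M\<close> is fixed from then
  on.\<close>

lemma Lpb_one_approx:
  assumes X: "X \<in> Lpb H \<P> 1" and e: "0 < e"
  obtains Z M where "Z \<in> H" "\<And>\<omega>. \<bar>Z \<omega>\<bar> \<le> M"
    "upper_expectation \<P> (\<lambda>\<omega>. \<bar>Z \<omega> - X \<omega>\<bar>) < ennreal e"
proof -
  obtain Z where Z: "\<And>k. Z k \<in> H" "\<And>k. bounded (range (Z k))"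
    and lim: "(\<lambda>k. upper_expectation \<P> (\<lambda>\<omega>. \<bar>Z k \<omega> - X \<omega>\<bar>)) \<longlonglongrightarrow> 0"
    using X by (auto simp: Lpb_def Lp_completion_def Lp_norm_one)
  from e have "0 < ennreal e"
    by simp
  from order_tendstoD(2)[OF lim this]
  obtain k where k: "upper_expectation \<P> (\<lambda>\<omega>. \<bar>Z k \<omega> - X \<omega>\<bar>) < ennreal e"
    by (auto simp: eventually_sequentially)
  obtain M where "\<And>\<omega>. \<bar>Z k \<omega>\<bar> \<le> M"
    using Z(2)[of k] by (auto simp: bounded_iff)
  with Z(1) k that show thesis
    by blast
qed

context sublinear_expectation_space
begin

lemma capacity_nonneg:
  assumes "A \<in> sets borel"
  shows "0 \<le> capacity E A"
proof -
  have "E (\<lambda>_. 0) \<le> E (indicator A)"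
    by (rule E_mono) (auto intro: H_indicator assms H_const)
  then show ?thesis
    by (simp add: capacity_def E_const)
qed

text \<open>The capacity of \<open>A\<close> is the supremum of the masses of \<open>A\<close> over
  \<P>. This carries information on capacities to each single measure.\<close>

lemma emeasure_le_capacity:
  assumes A: "A \<in> sets borel" and P: "P \<in> \<P>"
  shows "emeasure P A \<le> ennreal (capacity E A)"
proof -
  have "emeasure P A = (\<integral>\<^sup>+\<omega>. ennreal (indicator A \<omega>) \<partial>P)"
    using A sets_P[OF P] by (simp add: ennreal_indicator)
  also have "\<dots> \<le> upper_expectation \<P> (indicator A)"
    unfolding upper_expectation_def by (rule SUP_upper[OF P])
  also have "\<dots> = ennreal (capacity E A)"
    unfolding capacity_def by (rule upper_expectation_eq) (auto intro: H_indicator A)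
  finally show ?thesis .
qed

text \<open>A set of capacity zero is null under every \<open>P\<close>, so quasi-sure bounds may be
  used inside ordinary integrals.\<close>

lemma quasi_surely_AE:
  assumes "quasi_surely E Q" and P: "P \<in> \<P>"
  shows "AE \<omega> in P. Q \<omega>"
proof -
  obtain N where N: "N \<in> sets borel" "capacity E N = 0" "{\<omega>. \<not> Q \<omega>} \<subseteq> N"
    using assms(1) by (auto simp: quasi_surely_def)
  have "emeasure P N = 0"
    using emeasure_le_capacity[OF N(1) P] N(2) by simp
  then have "N \<in> null_sets P"
    using N(1) sets_P[OF P] by auto
  then show ?thesis
    by (rule AE_I') (use N(3) in auto)
qed

text \<open>The estimate is made under each \<open>P\<close> separately, with a bound free of
  \<open>P\<close>. That bound involves \<open>W\<close> only through a capacity, so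
  \<open>U\<close> and \<open>Z\<close> can be chosen once for a whole sequence of
  \<open>W\<close>.\<close>

lemma upper_expectation_diff_le:
  assumes [measurable]: "W \<in> borel_measurable borel" "X \<in> borel_measurable borel"
      "Y \<in> borel_measurable borel" "U \<in> borel_measurable borel" "Z \<in> borel_measurable borel"
    and dom: "quasi_surely E (\<lambda>\<omega>. \<bar>W \<omega>\<bar> \<le> Y \<omega>)"
    and U: "\<And>\<omega>. \<bar>U \<omega>\<bar> \<le> M" and Z: "\<And>\<omega>. \<bar>Z \<omega>\<bar> \<le> K" and d: "0 < d"
  shows "upper_expectation \<P> (\<lambda>\<omega>. \<bar>W \<omega> - X \<omega>\<bar>)
    \<le> upper_expectation \<P> (\<lambda>\<omega>. \<bar>U \<omega> - Y \<omega>\<bar>) + upper_expectation \<P> (\<lambda>\<omega>. \<bar>Z \<omega> - X \<omega>\<bar>)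
      + ennreal (d + (M + K) * capacity E {\<omega>. d \<le> \<bar>W \<omega> - X \<omega>\<bar>})"
  (is "_ \<le> ?u + ?z + _")
  unfolding upper_expectation_def[of _ "\<lambda>\<omega>. \<bar>W \<omega> - X \<omega>\<bar>"]
proof (rule SUP_least)
  fix P assume P: "P \<in> \<P>"
  interpret prob_space P using prob[OF P] .
  note [measurable_cong] = sets_P[OF P]
  define A where "A = {\<omega>. d \<le> \<bar>W \<omega> - X \<omega>\<bar>}"
  have A[measurable]: "A \<in> sets borel"
    unfolding A_def by measurable
  \<comment> \<open>\<open>ennreal\<close> sends negative reals to 0, so splitting sums and products
    below requires nonnegative constants.\<close>
  have MK: "0 \<le> M" "0 \<le> K"
    using order_trans[OF abs_ge_zero U] order_trans[OF abs_ge_zero Z] by auto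
  have "(\<integral>\<^sup>+\<omega>. ennreal \<bar>W \<omega> - X \<omega>\<bar> \<partial>P)
      \<le> (\<integral>\<^sup>+\<omega>. ennreal \<bar>U \<omega> - Y \<omega>\<bar> + ennreal \<bar>Z \<omega> - X \<omega>\<bar>
          + (ennreal d + ennreal (M + K) * indicator A \<omega>) \<partial>P)"
    using quasi_surely_AE[OF dom P]
  proof (intro nn_integral_mono_AE, eventually_elim)
    case (elim \<omega>)
    \<comment> \<open>The term \<open>d\<close> is kept on \<open>A\<close> too: as a constant it
      integrates to \<open>d\<close> under a probability measure.\<close>
    have "\<bar>W \<omega> - X \<omega>\<bar> \<le> \<bar>U \<omega> - Y \<omega>\<bar> + \<bar>Z \<omega> - X \<omega>\<bar> + (d + (M + K) * indicator A \<omega>)"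
      using elim U[of \<omega>] Z[of \<omega>] d by (cases "\<omega> \<in> A") (auto simp: A_def)
    then have "ennreal \<bar>W \<omega> - X \<omega>\<bar>
        \<le> ennreal (\<bar>U \<omega> - Y \<omega>\<bar> + \<bar>Z \<omega> - X \<omega>\<bar> + (d + (M + K) * indicator A \<omega>))"
      by (rule ennreal_leI)
    also have "\<dots> = ennreal \<bar>U \<omega> - Y \<omega>\<bar> + ennreal \<bar>Z \<omega> - X \<omega>\<bar>
        + (ennreal d + ennreal (M + K) * indicator A \<omega>)"
      using MK d by (simp add: ennreal_plus ennreal_mult ennreal_indicator)
    finally show ?case .
  qed
  also have "\<dots> = (\<integral>\<^sup>+\<omega>. ennreal \<bar>U \<omega> - Y \<omega>\<bar> \<partial>P) + (\<integral>\<^sup>+\<omega>. ennreal \<bar>Z \<omega> - X \<omega>\<bar> \<partial>P)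
      + (ennreal d + ennreal (M + K) * emeasure P A)"
    by (simp add: nn_integral_add nn_integral_cmult_indicator emeasure_space_1)
  also have "\<dots> \<le> ?u + ?z + (ennreal d + ennreal (M + K) * ennreal (capacity E A))"
    unfolding upper_expectation_def
    by (intro add_mono mult_left_mono SUP_upper P emeasure_le_capacity A order_refl) simp
  also have "\<dots> = ?u + ?z + ennreal (d + (M + K) * capacity E A)"
    using MK d capacity_nonneg[OF A] by (simp add: ennreal_plus ennreal_mult)
  finally show "(\<integral>\<^sup>+\<omega>. ennreal \<bar>W \<omega> - X \<omega>\<bar> \<partial>P) \<le> ?u + ?z
      + ennreal (d + (M + K) * capacity E {\<omega>. d \<le> \<bar>W \<omega> - X \<omega>\<bar>})"
    by (simp only: A_def)
qed

end

theorem theorem3p1: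
  fixes H :: "('a::polish_space \<Rightarrow> real) set"
    and E :: "('a \<Rightarrow> real) \<Rightarrow> real"
    and \<P> :: "'a measure set"
    and Xs :: "nat \<Rightarrow> 'a \<Rightarrow> real"
    and X Y :: "'a \<Rightarrow> real"
  assumes "sublinear_expectation_space H E \<P>"
    and "\<And>n. 1 \<le> n \<Longrightarrow> Xs n \<in> Lp H \<P> 1"
    and "Y \<in> Lpb H \<P> 1"
    and "\<And>n. 1 \<le> n \<Longrightarrow> quasi_surely E (\<lambda>\<omega>. \<bar>Xs n \<omega>\<bar> \<le> Y \<omega>)"
    and "converges_in_capacity E Xs X"
    and "X \<in> Lpb H \<P> 1"
  shows "(\<lambda>n. upper_expectation \<P> (\<lambda>\<omega>. \<bar>Xs n \<omega> - X \<omega>\<bar>)) \<longlonglongrightarrow> 0"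
proof (rule order_tendstoI)
  interpret sublinear_expectation_space H E \<P>
    by (fact assms(1))
  fix a :: ennreal assume "0 < a"
  \<comment> \<open>As \<open>a\<close> may be infinite, pass to a smaller positive value, which is
    a real \<open>s\<close>.\<close>
  then obtain y where y: "0 < y" "y < a"
    using dense by blast
  then obtain s where s: "y = ennreal s" "0 < s"
    by (cases y) auto
  \<comment> \<open>Four errors share \<open>s\<close>: the two approximations, the threshold
    \<open>d\<close>, and the capacity term.\<close>
  define d where "d = s / 4"
  have d: "0 < d"
    using s by (simp add: d_def)
  obtain U M where U: "U \<in> borel_measurable borel" "\<And>\<omega>. \<bar>U \<omega>\<bar> \<le> M"
      "upper_expectation \<P> (\<lambda>\<omega>. \<bar>U \<omega> - Y \<omega>\<bar>) < ennreal d"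
    using Lpb_one_approx[OF assms(3) d] H_measurable by metis
  obtain Z K where Z: "Z \<in> borel_measurable borel" "\<And>\<omega>. \<bar>Z \<omega>\<bar> \<le> K"
      "upper_expectation \<P> (\<lambda>\<omega>. \<bar>Z \<omega> - X \<omega>\<bar>) < ennreal d"
    using Lpb_one_approx[OF assms(6) d] H_measurable by metis
  let ?c = "\<lambda>n. capacity E {\<omega>. d \<le> \<bar>Xs n \<omega> - X \<omega>\<bar>}"
  have "(\<lambda>n. (M + K) * ?c n) \<longlonglongrightarrow> 0"
    using assms(5) d by (auto simp: converges_in_capacity_def intro: tendsto_mult_right_zero)
  then have "\<forall>\<^sub>F n in sequentially. (M + K) * ?c n < d"
    using d by (rule order_tendstoD)
  then show "\<forall>\<^sub>F n in sequentially. upper_expectation \<P> (\<lambda>\<omega>. \<bar>Xs n \<omega> - X \<omega>\<bar>) < a"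
    \<comment> \<open>Membership in \<open>Lp\<close> and domination by \<open>Y\<close> are assumed
      from index 1 on.\<close>
    using eventually_ge_at_top[of 1]
  proof eventually_elim
    case (elim n)
    have "upper_expectation \<P> (\<lambda>\<omega>. \<bar>Xs n \<omega> - X \<omega>\<bar>)
        \<le> upper_expectation \<P> (\<lambda>\<omega>. \<bar>U \<omega> - Y \<omega>\<bar>) + upper_expectation \<P> (\<lambda>\<omega>. \<bar>Z \<omega> - X \<omega>\<bar>)
          + ennreal (d + (M + K) * ?c n)"
      using assms(2)[OF elim(2)] assms(3,6)
      by (intro upper_expectation_diff_le assms(4) elim U Z d)
        (auto simp: Lp_def Lpb_def Lp_completion_def)
    also have "\<dots> \<le> ennreal d + ennreal d + ennreal (d + d)"
      using U(3) Z(3) elim(1) by (intro add_mono ennreal_leI) auto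
    also have "\<dots> = y"
      using d s by (simp add: d_def flip: ennreal_plus)
    also have "\<dots> < a"
      by (fact y(2))
    finally show ?case .
  qed
\<comment> \<open>The lower half of the order criterion is vacuous, as no \<open>ennreal\<close>
  lies below 0.\<close>
qed simp

end
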